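(* If $H$ is a fixed nice graph, then $g(n,H)=\Omega(n^{1/6})$ as $n\to\infty$.
   Context: A graph $H$ is called nice if it contains four distinct edges $e_1,e_2,f_1,f_2$ (each edge viewed as a 2-element vertex set) such that $(e_1\cup e_2)\cap(f_1\cup f_2)\subseteq f_1\cap f_2$. For a positive integer $n$ and a graph $H$: for each vertex $v$ of the complete graph $K_n$ let $f_v$ be a (not necessarily proper) colouring of the edges of the same $K_n$. The collection $\{f_v\}$ is called $(n,H)$-local if for every copy $T$ of $H$ in $K_n$ (i.e. every subgraph of $K_n$ isomorphic to $H$), there exists a vertex $u\in V(T)$ such that all edges of $T$ receive pairwise different colours in $f_u$. $g(n,H)$ is the smallest $k$ for which there is an $(n,H)$-local collection of colourings each using at most $k$ colours. *)

theory Defs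
  imports Complex_Main "HOL-Library.Landau_Symbols"
begin

record 'a graph =
  verts :: "'a set"
  edges :: "'a set set"

definition simple_graph :: "'a graph \<Rightarrow> bool" where
  "simple_graph H \<longleftrightarrow> finite (verts H) \<and> edges H \<subseteq> {e. e \<subseteq> verts H \<and> card e = 2}"

definition nice :: "'a graph \<Rightarrow> bool" where
  "nice H \<longleftrightarrow> (\<exists>e1\<in>edges H. \<exists>e2\<in>edges H. \<exists>f1\<in>edges H. \<exists>f2\<in>edges H.
     distinct [e1, e2, f1, f2] \<and> (e1 \<union> e2) \<inter> (f1 \<union> f2) \<subseteq> f1 \<inter> f2)"

definition complete_graph :: "nat \<Rightarrow> nat graph" where
  "complete_graph n = \<lparr>verts = {1..n}, edges = {e. e \<subseteq> {1..n} \<and> card e = 2}\<rparr>"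

definition subgraph :: "'a graph \<Rightarrow> 'a graph \<Rightarrow> bool" where
  "subgraph T G \<longleftrightarrow> simple_graph T \<and> verts T \<subseteq> verts G \<and> edges T \<subseteq> edges G"

definition graph_isomorphic :: "'a graph \<Rightarrow> 'b graph \<Rightarrow> bool" where
  "graph_isomorphic H T \<longleftrightarrow>
     (\<exists>\<phi>. bij_betw \<phi> (verts H) (verts T) \<and> edges T = (\<lambda>e. \<phi> ` e) ` edges H)"

text \<open>Copies are not required to be induced; isolated vertices of \<open>H\<close> are part of a copy.\<close>

definition copies :: "nat \<Rightarrow> 'a graph \<Rightarrow> nat graph set" where
  "copies n H = {T. subgraph T (complete_graph n) \<and> graph_isomorphic H T}"

text \<open>In a collection \<open>f\<close>, the colour that the colouring at vertex \<open>v\<close> gives to edge \<open>e\<close> is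
  \<open>f v e\<close>. Natural numbers serve as colours without loss of generality, since \<open>K_n\<close> is finite.
  Only the values at vertices and edges of \<open>K_n\<close> are relevant.\<close>

definition local_collection :: "nat \<Rightarrow> 'a graph \<Rightarrow> (nat \<Rightarrow> nat set \<Rightarrow> nat) \<Rightarrow> bool" where
  "local_collection n H f \<longleftrightarrow> (\<forall>T\<in>copies n H. \<exists>u\<in>verts T. inj_on (f u) (edges T))"

definition uses_at_most :: "nat \<Rightarrow> (nat \<Rightarrow> nat set \<Rightarrow> nat) \<Rightarrow> nat \<Rightarrow> bool" where
  "uses_at_most n f k \<longleftrightarrow>
     (\<forall>v\<in>verts (complete_graph n). card (f v ` edges (complete_graph n)) \<le> k)"

definition g :: "nat \<Rightarrow> 'a graph \<Rightarrow> nat" where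
  "g n H = (LEAST k. \<exists>f. local_collection n H f \<and> uses_at_most n f k)"

text \<open>The minimum is attained as soon as \<open>H\<close> has a vertex (in particular if \<open>H\<close> is nice):
  give all edges of \<open>K_n\<close> different colours.\<close>

lemma g_attained:
  assumes "verts H \<noteq> {}"
  shows "\<exists>f. local_collection n H f \<and> uses_at_most n f (g n H)"
proof -
  have "edges (complete_graph n) \<subseteq> Pow {1..n}"
    by (auto simp: complete_graph_def)
  then have "finite (edges (complete_graph n))"
    by (rule finite_subset) simp
  then obtain c :: "nat set \<Rightarrow> nat" where c: "inj_on c (edges (complete_graph n))"
    using finite_imp_inj_to_nat_seg by blast
  have "local_collection n H (\<lambda>_. c)"
    unfolding local_collection_def
  proof
    fix T assume "T \<in> copies n H"
    then have sub: "edges T \<subseteq> edges (complete_graph n)" and iso: "graph_isomorphic H T"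
      by (auto simp: copies_def subgraph_def)
    from iso have "verts T \<noteq> {}"
      using assms by (auto simp: graph_isomorphic_def bij_betw_def)
    with inj_on_subset[OF c sub] show "\<exists>u\<in>verts T. inj_on c (edges T)"
      by blast
  qed
  moreover have "uses_at_most n (\<lambda>_. c) (card (c ` edges (complete_graph n)))"
    by (simp add: uses_at_most_def)
  ultimately have "\<exists>k f. local_collection n H f \<and> uses_at_most n f k"
    by blast
  then show ?thesis
    unfolding g_def by (rule LeastI_ex)
qed

end

(* Let A be the union of e1 and e2, and suppose every colouring uses at most k colours.
   Among k + 1 edges of K_n forming a matching or a star, every vertex u sees two edges of the same
   colour, so some pair of them, playing the role of e1 and e2, is monochromatic for at least about
   n / k^2 vertices u; call the set of these U.  The at most four vertices of A together induce a
   colouring with at most k^4 colours, so if n / k^2 is large compared with k^4, there are two edges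
   with ends in U (or in U and one prescribed vertex of A) that agree in all of these colourings and
   can play the role of f1 and f2.  Placing the rest of H inside U gives a copy in which the vertices
   of A see f1 and f2 in one colour and all others see e1 and e2 in one colour. *)
theory Submission imports Defs "HOL-Library.FuncSet"
begin

section \<open>Pigeonhole principles for monochromatic pairs\<close>

text \<open>With fewer colours than edges, no \<open>f u\<close> is injective on \<open>E\<close>,
  so each \<open>u\<close> in \<open>V\<close> lies in \<open>F (e, e')\<close> for some ordered
  pair of distinct edges. There are at most \<open>(card E)\<^sup>2\<close> such pairs, and
  averaging over them yields a popular one.\<close>

lemma popular_monochromatic_pair:
  fixes f :: "'v \<Rightarrow> 'e \<Rightarrow> 'c"
  assumes "finite E" "finite V"
    and few: "\<And>u. u \<in> V \<Longrightarrow> card (f u ` E) < card E"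
    and large: "card V > m * (card E)\<^sup>2"
  obtains e e' where "e \<in> E" "e' \<in> E" "e \<noteq> e'" "card {u \<in> V. f u e = f u e'} > m"
proof -
  define P where "P = {(e, e'). e \<in> E \<and> e' \<in> E \<and> e \<noteq> e'}"
  have PE: "P \<subseteq> E \<times> E" by (auto simp: P_def)
  then have finP: "finite P" using \<open>finite E\<close> by (meson finite_SigmaI finite_subset)
  have cP: "card P \<le> (card E)\<^sup>2"
    using card_mono[OF _ PE] \<open>finite E\<close> by (simp add: card_cartesian_product power2_eq_square)
  define F where "F = (\<lambda>(e, e'). {u \<in> V. f u e = f u e'})"
  have "V \<subseteq> \<Union> (F ` P)"
  proof
    fix u assume u: "u \<in> V"
    have "\<not> inj_on (f u) E" using few[OF u] by (metis card_image less_irrefl)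
    then obtain e e' where "e \<in> E" "e' \<in> E" "e \<noteq> e'" "f u e = f u e'"
      unfolding inj_on_def by blast
    with u have "(e, e') \<in> P" "u \<in> F (e, e')" by (auto simp: P_def F_def)
    then show "u \<in> \<Union> (F ` P)" by blast
  qed
  moreover have "finite (\<Union> (F ` P))"
    using finP \<open>finite V\<close> by (auto simp: F_def)
  ultimately have "card V \<le> card (\<Union> (F ` P))" by (intro card_mono)
  also have "\<dots> \<le> (\<Sum>p\<in>P. card (F p))" by (rule card_UN_le[OF finP])
  finally have V_le: "card V \<le> (\<Sum>p\<in>P. card (F p))" .
  have "\<exists>p\<in>P. card (F p) > m"
  proof (rule ccontr)
    assume "\<not> ?thesis"
    then have "(\<Sum>p\<in>P. card (F p)) \<le> card P * m"
      using sum_bounded_above[of P "\<lambda>p. card (F p)" m] by (auto simp: not_less)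
    also have "\<dots> \<le> m * (card E)\<^sup>2" using cP by (simp add: mult.commute)
    finally show False using large V_le by linarith
  qed
  then show ?thesis using that by (auto simp: P_def F_def)
qed

text \<open>Each edge determines a vector of colours, one entry for each vertex of \<open>A\<close>.
  At most \<open>k ^ card A\<close> vectors occur, so two edges share theirs.\<close>

lemma common_monochromatic_pair:
  fixes f :: "'v \<Rightarrow> 'e \<Rightarrow> 'c"
  assumes "finite E" "finite A"
    and few: "\<And>u. u \<in> A \<Longrightarrow> card (f u ` E) \<le> k"
    and large: "card E > k ^ card A"
  obtains e e' where "e \<in> E" "e' \<in> E" "e \<noteq> e'" "\<forall>u\<in>A. f u e = f u e'"
proof -
  \<comment> \<open>Restricting to \<open>A\<close> makes the colour vector a member of the finite
    product \<open>?R\<close>, whose size is known.\<close>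
  let ?h = "\<lambda>e. restrict (\<lambda>u. f u e) A"
  let ?R = "PiE A (\<lambda>u. f u ` E)"
  have "card ?R \<le> k ^ card A"
    using prod_mono[of A "\<lambda>u. card (f u ` E)" "\<lambda>_. k"] few \<open>finite A\<close>
    by (simp add: card_PiE)
  moreover have "finite ?R" using assms by (intro finite_PiE) auto
  moreover have "?h ` E \<subseteq> ?R" by auto
  ultimately have "\<not> inj_on ?h E"
    using large by (metis card_inj_on_le leD le_trans)
  then obtain e e' where e: "e \<in> E" "e' \<in> E" "e \<noteq> e'" "?h e = ?h e'"
    unfolding inj_on_def by blast
  have "f u e = f u e'" if "u \<in> A" for u
    using fun_cong[OF e(4), of u] that by simp
  with e that show ?thesis by blast
qed

lemma extend_injection:
  assumes "finite X" "finite U" "Y \<subseteq> X" "inj_on p Y" "p ` Y \<subseteq> U" "card X \<le> card U"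
  obtains q where "inj_on q X" "q ` X \<subseteq> U" "\<forall>y\<in>Y. q y = p y"
proof -
  have finY: "finite Y" using assms finite_subset by blast
  have "card (X - Y) \<le> card (U - p ` Y)"
    using assms finY by (simp add: card_Diff_subset card_image)
  then obtain r where r: "r ` (X - Y) \<subseteq> U - p ` Y" "inj_on r (X - Y)"
    using card_le_inj[of "X - Y" "U - p ` Y"] assms by auto
  let ?q = "\<lambda>x. if x \<in> Y then p x else r x"
  have Y: "inj_on ?q Y" "?q ` Y = p ` Y"
    using assms(4) by (simp_all add: inj_on_def)
  have X: "inj_on ?q (X - Y)" "?q ` (X - Y) \<subseteq> U - p ` Y"
    using r by (auto simp: inj_on_def)
  have "inj_on ?q (Y \<union> (X - Y))" unfolding inj_on_Un using X Y by blast
  then have "inj_on ?q X" using assms(3) by (simp add: Un_absorb1)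
  moreover have "?q ` X \<subseteq> U" using X(2) Y(2) assms(5) by blast
  ultimately show ?thesis by (rule that) simp
qed

section \<open>Families of edges in which any two realise a given configuration\<close>

lemma matching_exists:
  fixes W :: "'b set"
  assumes "finite W" "2 * N \<le> card W"
  shows "\<exists>E. finite E \<and> card E = N \<and> (\<forall>e\<in>E. e \<subseteq> W \<and> card e = 2) \<and> pairwise disjnt E"
  using assms
proof (induction N arbitrary: W)
  case 0
  show ?case by (intro exI[of _ "{}"]) auto
next
  case (Suc N)
  have "2 \<le> card W" using Suc.prems by simp
  then obtain d where d: "d \<subseteq> W" "card d = 2" "finite d"
    by (rule obtain_subset_with_card_n)
  have "2 * N \<le> card (W - d)" using d Suc.prems by (simp add: card_Diff_subset)
  then obtain E where E: "finite E" "card E = N" "\<forall>e\<in>E. e \<subseteq> W - d \<and> card e = 2" "pairwise disjnt E"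
    using Suc.IH[of "W - d"] Suc.prems by auto
  \<comment> \<open>The edges of \<open>E\<close> avoid \<open>d\<close>, so \<open>d\<close> could
    belong to \<open>E\<close> only if it were empty; hence the family really grows by one.\<close>
  have "d \<notin> E"
  proof
    assume "d \<in> E"
    then have "d = {}" using E(3) by blast
    then show False using d by simp
  qed
  moreover have "pairwise disjnt (insert d E)"
    using E by (auto simp: pairwise_insert disjnt_def)
  ultimately show ?case
    using E d by (intro exI[of _ "insert d E"]) auto
qed

text \<open>In a star any two edges meet exactly in the centre, just as \<open>f1\<close> and
  \<open>f2\<close> meet in \<open>c\<close>. The centre \<open>a\<close> is prescribed and lies
  outside \<open>W\<close> because the image of \<open>c\<close> may already be fixed when the star
  is chosen.\<close>

lemma cherry_family:
  fixes W :: "'b set" and a :: 'b and f1 f2 :: "'a set"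
  assumes "finite W" "a \<notin> W" "card f1 = 2" "card f2 = 2" "f1 \<inter> f2 = {c}"
  obtains E where "card E = card W" "finite E" "\<And>e. e \<in> E \<Longrightarrow> e \<subseteq> insert a W \<and> card e = 2"
    "\<And>e e'. e \<in> E \<Longrightarrow> e' \<in> E \<Longrightarrow> e \<noteq> e' \<Longrightarrow>
       \<exists>\<phi>. inj_on \<phi> (f1 \<union> f2) \<and> \<phi> ` f1 = e \<and> \<phi> ` f2 = e' \<and> \<phi> c = a
         \<and> \<phi> ` (f1 \<union> f2 - {c}) \<subseteq> W"
proof
  let ?E = "(\<lambda>x. {a, x}) ` W"
  have "inj_on (\<lambda>x. {a, x}) W" using \<open>a \<notin> W\<close> by (auto simp: inj_on_def doubleton_eq_iff)
  then show "card ?E = card W" by (rule card_image)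
  show "finite ?E" using assms by simp
  show "e \<subseteq> insert a W \<and> card e = 2" if "e \<in> ?E" for e
    using that \<open>a \<notin> W\<close> by (auto simp: card_2_iff)
  have other: "\<exists>x. e = {c, x} \<and> x \<noteq> c" if "card e = 2" "c \<in> e" for e :: "'a set"
    using that unfolding card_2_iff by (metis insertE insert_commute singletonD)
  obtain x1 where x1: "f1 = {c, x1}" "x1 \<noteq> c" using other[of f1] assms by blast
  obtain x2 where x2: "f2 = {c, x2}" "x2 \<noteq> c" using other[of f2] assms by blast
  have "x1 \<noteq> x2" using assms x1 x2 by auto
  fix e e' assume "e \<in> ?E" "e' \<in> ?E" "e \<noteq> e'"
  then obtain y1 y2 where y: "e = {a, y1}" "e' = {a, y2}" "y1 \<in> W" "y2 \<in> W" "y1 \<noteq> y2" by auto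
  \<comment> \<open>On \<open>f1 \<union> f2\<close> the last branch is reached only by
    \<open>x2\<close>.\<close>
  define \<phi> where "\<phi> = (\<lambda>x. if x = c then a else if x = x1 then y1 else y2)"
  have "inj_on \<phi> (f1 \<union> f2)"
    using y x1 x2 \<open>x1 \<noteq> x2\<close> \<open>a \<notin> W\<close> by (auto simp: \<phi>_def inj_on_def)
  moreover have "\<phi> ` f1 = e" "\<phi> ` f2 = e'" "\<phi> c = a" "\<phi> ` (f1 \<union> f2 - {c}) \<subseteq> W"
    using y x1 x2 \<open>x1 \<noteq> x2\<close> by (auto simp: \<phi>_def)
  ultimately show "\<exists>\<phi>. inj_on \<phi> (f1 \<union> f2) \<and> \<phi> ` f1 = e \<and> \<phi> ` f2 = e' \<and> \<phi> c = a
         \<and> \<phi> ` (f1 \<union> f2 - {c}) \<subseteq> W" by blast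
qed

text \<open>Two distinct edges are disjoint or share exactly one vertex. A matching serves the first
  case and a star with a freely chosen centre the second.\<close>

lemma edge_pair_family:
  fixes W :: "'b set"
  assumes "finite W" "2 * N \<le> card W" "N \<ge> 1" "card f1 = 2" "card f2 = 2" "f1 \<noteq> f2"
  obtains E where "finite E" "card E = N" "\<And>e. e \<in> E \<Longrightarrow> e \<subseteq> W \<and> card e = 2"
    "\<And>e e'. e \<in> E \<Longrightarrow> e' \<in> E \<Longrightarrow> e \<noteq> e' \<Longrightarrow>
       \<exists>\<phi>. inj_on \<phi> (f1 \<union> f2) \<and> \<phi> ` f1 = e \<and> \<phi> ` f2 = e'"
proof (cases "f1 \<inter> f2 = {}")
  case True
  obtain E where E: "finite E" "card E = N" "\<forall>e\<in>E. e \<subseteq> W \<and> card e = 2" "pairwise disjnt E"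
    using matching_exists[OF assms(1,2)] by blast
  have maps: "\<exists>\<phi>. inj_on \<phi> (f1 \<union> f2) \<and> \<phi> ` f1 = e \<and> \<phi> ` f2 = e'"
    if "e \<in> E" "e' \<in> E" "e \<noteq> e'" for e e'
  proof -
    have dis: "e \<inter> e' = {}" using E(4) that by (auto simp: pairwise_def disjnt_def)
    have fin: "finite e" "finite e'" "finite f1" "finite f2"
      using E(3) that assms by (metis card.infinite zero_neq_numeral)+
    have cards: "card f1 = card e" "card f2 = card e'" using E(3) that assms by auto
    obtain p where p: "bij_betw p f1 e"
      using finite_same_card_bij[OF fin(3,1) cards(1)] by blast
    obtain q where q: "bij_betw q f2 e'"
      using finite_same_card_bij[OF fin(4,2) cards(2)] by blast
    let ?\<phi> = "\<lambda>x. if x \<in> f1 then p x else q x"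
    have 1: "?\<phi> ` f1 = e" using p by (auto simp: bij_betw_def)
    have 2: "?\<phi> ` f2 = q ` f2" using True by (intro image_cong) auto
    have 3: "inj_on ?\<phi> f1" using p by (simp add: bij_betw_def inj_on_def)
    have 4: "inj_on ?\<phi> f2" using q True by (auto simp: bij_betw_def inj_on_def)
    have 5: "?\<phi> ` f2 = e'" using 2 q by (simp add: bij_betw_def)
    have "inj_on ?\<phi> (f1 \<union> f2)"
      unfolding inj_on_Un using 1 3 4 5 dis by blast
    then show ?thesis using 1 5 by blast
  qed
  show ?thesis by (rule that[OF E(1,2)]) (use E(3) maps in auto)
next
  case False
  have "finite f1" using assms by (metis card.infinite zero_neq_numeral)
  then obtain c where c: "f1 \<inter> f2 = {c}"
    using False assms by (auto simp: card_2_iff)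
  \<comment> \<open>A star with \<open>N\<close> edges needs one vertex more for its centre;
    \<open>N + 1 \<le> 2 * N\<close> since \<open>N \<ge> 1\<close>.\<close>
  have "N + 1 \<le> card W" using assms by simp
  then obtain W' where W': "W' \<subseteq> W" "card W' = N + 1" "finite W'"
    by (rule obtain_subset_with_card_n)
  then obtain a where a: "a \<in> W'" by fastforce
  obtain E where E: "card E = card (W' - {a})" "finite E"
    "\<And>e. e \<in> E \<Longrightarrow> e \<subseteq> insert a (W' - {a}) \<and> card e = 2"
    "\<And>e e'. e \<in> E \<Longrightarrow> e' \<in> E \<Longrightarrow> e \<noteq> e' \<Longrightarrow>
       \<exists>\<phi>. inj_on \<phi> (f1 \<union> f2) \<and> \<phi> ` f1 = e \<and> \<phi> ` f2 = e' \<and> \<phi> c = a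
         \<and> \<phi> ` (f1 \<union> f2 - {c}) \<subseteq> W' - {a}"
    using cherry_family[of "W' - {a}" a f1 f2 c] W' assms c by auto
  have W'': "insert a (W' - {a}) \<subseteq> W" "card (W' - {a}) = N"
    using a W' by auto
  show ?thesis
  proof
    show "finite E" "card E = N" using E(1,2) W'' by auto
    show "e \<subseteq> W \<and> card e = 2" if "e \<in> E" for e
      using E(3)[OF that] W''(1) by auto
    show "\<exists>\<phi>. inj_on \<phi> (f1 \<union> f2) \<and> \<phi> ` f1 = e \<and> \<phi> ` f2 = e'"
      if "e \<in> E" "e' \<in> E" "e \<noteq> e'" for e e'
      using E(4)[OF that] by blast
  qed
qed

section \<open>The polynomial bound on n\<close>

text \<open>The exponent 6 is 2 + 4: a factor of order \<open>K\<^sup>2\<close> is lost to the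
  choice of a popular pair, and \<open>K ^ 4\<close> bounds the number of colour vectors on at most
  four vertices.\<close>

lemma local_collection_bound:
  fixes H :: "'a graph"
  assumes H: "simple_graph H" "nice H"
    and loc: "local_collection n H f" and few: "uses_at_most n f k"
  shows "n \<le> (6 + card (verts H)) * (k + 1) ^ 6"
proof (rule ccontr)
  assume neg: "\<not> ?thesis"
  define h where "h = card (verts H)"
  define K where "K = k + 1"
  let ?Kn = "edges (complete_graph n)"
  have finKn: "finite ?Kn"
    by (rule finite_subset[of _ "Pow {1..n}"]) (auto simp: complete_graph_def)
  have Kn: "e \<in> ?Kn \<longleftrightarrow> e \<subseteq> {1..n} \<and> card e = 2" for e
    by (simp add: complete_graph_def)
  have few': "card (f u ` E) \<le> k" if "u \<in> {1..n}" "E \<subseteq> ?Kn" for u E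
  proof -
    have "card (f u ` E) \<le> card (f u ` ?Kn)" using that finKn by (intro card_mono) auto
    also have "\<dots> \<le> k" using few that by (auto simp: uses_at_most_def complete_graph_def)
    finally show ?thesis .
  qed
  obtain e1 e2 f1 f2 where ef: "e1 \<in> edges H" "e2 \<in> edges H" "f1 \<in> edges H" "f2 \<in> edges H"
    and dist: "distinct [e1, e2, f1, f2]" and sep: "(e1 \<union> e2) \<inter> (f1 \<union> f2) \<subseteq> f1 \<inter> f2"
    using H(2) unfolding nice_def by blast
  have finH: "finite (verts H)" using H by (simp add: simple_graph_def)
  have edgeH: "e \<subseteq> verts H" "card e = 2" if "e \<in> edges H" for e
    using that H by (auto simp: simple_graph_def)
  define A where "A = e1 \<union> e2"
  define B where "B = f1 \<union> f2"
  have AB: "A \<subseteq> verts H" "B \<subseteq> verts H" using edgeH ef by (auto simp: A_def B_def)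
  have cA: "card A \<le> 4" using card_Un_le[of e1 e2] edgeH ef by (simp add: A_def)
  have K1: "K \<ge> 1" by (simp add: K_def)
  \<comment> \<open>The term \<open>2 * K\<close> pays for the vertices carrying the first family of
    edges, and \<open>K\<^sup>2\<close> for the ordered pairs in it. The popular set then has room
    for a matching of \<open>K ^ 4 + 1\<close> edges and for all vertices of
    \<open>H\<close>.\<close>
  have n_large: "n > 2 * K + (2 * (K ^ 4 + 1) + h) * K\<^sup>2"
  proof -
    have "K \<le> K ^ 6" "K\<^sup>2 \<le> K ^ 6"
      using K1 power_increasing[of 1 6 K] power_increasing[of 2 6 K] by auto
    moreover have "h * K\<^sup>2 \<le> h * K ^ 6" using calculation by simp
    moreover have "(2 * (K ^ 4 + 1) + h) * K\<^sup>2 = 2 * K ^ 6 + 2 * K\<^sup>2 + h * K\<^sup>2"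
      by (simp add: algebra_simps flip: power_add)
    moreover have "(6 + h) * K ^ 6 = 6 * K ^ 6 + h * K ^ 6" by (simp add: algebra_simps)
    ultimately have "2 * K + (2 * (K ^ 4 + 1) + h) * K\<^sup>2 \<le> (6 + h) * K ^ 6" by linarith
    also have "\<dots> < n" using neg by (simp add: h_def K_def)
    finally show ?thesis .
  qed
  \<comment> \<open>This block carries \<open>K = k + 1\<close> edges, one more than the number of
    colours.\<close>
  let ?W = "{1..2 * K}"
  obtain E where E: "finite E" "card E = K" "\<And>e. e \<in> E \<Longrightarrow> e \<subseteq> ?W \<and> card e = 2"
    "\<And>e e'. e \<in> E \<Longrightarrow> e' \<in> E \<Longrightarrow> e \<noteq> e' \<Longrightarrow>
       \<exists>\<phi>. inj_on \<phi> (e1 \<union> e2) \<and> \<phi> ` e1 = e \<and> \<phi> ` e2 = e'"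
    using edge_pair_family[of ?W K e1 e2] K1 edgeH ef dist by auto
  have Wn: "?W \<subseteq> {1..n}" using n_large by auto
  then have EKn: "E \<subseteq> ?Kn" using E(3) Kn by blast
  \<comment> \<open>Keeping \<open>V\<close> disjoint from \<open>?W\<close> ensures that images of
    \<open>A\<close>, which lie in \<open>?W\<close>, never collide with images chosen in
    \<open>U\<close>.\<close>
  define V where "V = {2 * K + 1..n}"
  have V: "finite V" "card V > (2 * (K ^ 4 + 1) + h) * (card E)\<^sup>2" "V \<subseteq> {1..n}"
    using n_large E(2) by (auto simp: V_def)
  have "card (f u ` E) < card E" if "u \<in> V" for u
    using few'[OF _ EKn, of u] that V(3) E(2) by (auto simp: K_def)
  then obtain e e' where e: "e \<in> E" "e' \<in> E" "e \<noteq> e'"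
      and U0: "card {u \<in> V. f u e = f u e'} > 2 * (K ^ 4 + 1) + h"
    by (rule popular_monochromatic_pair[OF E(1) V(1) _ V(2)])
  define U where "U = {u \<in> V. f u e = f u e'}"
  have U: "finite U" "U \<subseteq> {1..n}" "card U > 2 * (K ^ 4 + 1) + h" "U \<inter> ?W = {}"
    and Uf: "\<And>u. u \<in> U \<Longrightarrow> f u e = f u e'"
    using U0 V by (auto simp: U_def) (auto simp: V_def)
  obtain \<alpha> where \<alpha>: "inj_on \<alpha> A" "\<alpha> ` e1 = e" "\<alpha> ` e2 = e'"
    using E(4)[OF e] by (auto simp: A_def)
  have \<alpha>W: "\<alpha> ` A \<subseteq> ?W" unfolding A_def image_Un using \<alpha> E(3) e by auto
  \<comment> \<open>Passing from \<open>k\<close> to \<open>K \<ge> 1\<close> allows the exponent to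
    be raised to 4 even when \<open>e1\<close> and \<open>e2\<close> share a vertex.\<close>
  have cAk: "k ^ card (\<alpha> ` A) < Suc (K ^ 4)"
  proof -
    have "k ^ card (\<alpha> ` A) \<le> K ^ card (\<alpha> ` A)" by (intro power_mono) (auto simp: K_def)
    also have "\<dots> \<le> K ^ 4" using cA \<alpha>(1) K1 by (intro power_increasing) (auto simp: card_image)
    finally show ?thesis by simp
  qed
  have finA: "finite A" using AB finH finite_subset by blast
  \<comment> \<open>The map \<open>\<alpha>\<close> is fixed first, as \<open>U\<close> depends on
    \<open>e\<close> and \<open>e'\<close>; so \<open>\<beta>\<close> must respect it on the overlap
    of \<open>A\<close> and \<open>B\<close>.\<close>
  obtain \<beta> where \<beta>: "inj_on \<beta> B" "\<beta> ` (B - A) \<subseteq> U" "\<forall>v\<in>A \<inter> B. \<beta> v = \<alpha> v"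
    "\<forall>u\<in>\<alpha> ` A. f u (\<beta> ` f1) = f u (\<beta> ` f2)"
  proof (cases "A \<inter> B = {}")
    case True
    obtain F where F: "finite F" "card F = Suc (K ^ 4)" "\<And>d. d \<in> F \<Longrightarrow> d \<subseteq> U \<and> card d = 2"
      "\<And>d d'. d \<in> F \<Longrightarrow> d' \<in> F \<Longrightarrow> d \<noteq> d' \<Longrightarrow>
         \<exists>\<phi>. inj_on \<phi> (f1 \<union> f2) \<and> \<phi> ` f1 = d \<and> \<phi> ` f2 = d'"
      using edge_pair_family[of U "Suc (K ^ 4)" f1 f2] U edgeH ef dist by auto
    have "F \<subseteq> ?Kn" using F(3) Kn U by blast
    then have few_F: "card (f u ` F) \<le> k" if "u \<in> \<alpha> ` A" for u
      using few' that \<alpha>W Wn by blast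
    have large_F: "card F > k ^ card (\<alpha> ` A)" using F(2) cAk by simp
    obtain d d' where d: "d \<in> F" "d' \<in> F" "d \<noteq> d'"
      "\<forall>u\<in>\<alpha> ` A. f u d = f u d'"
      by (rule common_monochromatic_pair[OF F(1) finite_imageI[OF finA] few_F large_F])
    obtain \<phi> where \<phi>: "inj_on \<phi> (f1 \<union> f2)" "\<phi> ` f1 = d" "\<phi> ` f2 = d'" using F(4)[OF d(1-3)] by blast
    have "\<phi> ` B \<subseteq> U" unfolding B_def image_Un using \<phi> F(3) d by auto
    then have "\<phi> ` (B - A) \<subseteq> U" by blast
    then show ?thesis using \<phi> d(4) True by (intro that[of \<phi>]) (auto simp: B_def)
  next
    case False
    \<comment> \<open>By niceness a vertex common to \<open>A\<close> and \<open>B\<close> lies in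
      both \<open>f1\<close> and \<open>f2\<close>, and these distinct edges share at most one
      vertex. So only the image of \<open>c\<close> is prescribed, and a star centred at
      \<open>\<alpha> c\<close> with leaves in \<open>U\<close> supplies the candidate
      pairs.\<close>
    then obtain c where cAB: "c \<in> A \<inter> B" by blast
    then have c0: "c \<in> f1 \<inter> f2" using sep by (auto simp: A_def B_def)
    have c: "f1 \<inter> f2 = {c}"
      using c0 edgeH(2)[OF ef(3)] edgeH(2)[OF ef(4)] dist by (auto simp: card_2_iff)
    have AcB: "A \<inter> B = {c}" using c cAB sep by (auto simp: A_def B_def)
    have aW: "\<alpha> c \<in> ?W" using \<alpha>W cAB by blast
    have "\<alpha> c \<notin> U" using aW U(4) by blast
    then obtain F where F: "card F = card U" "finite F"
      "\<And>d. d \<in> F \<Longrightarrow> d \<subseteq> insert (\<alpha> c) U \<and> card d = 2"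
      "\<And>d d'. d \<in> F \<Longrightarrow> d' \<in> F \<Longrightarrow> d \<noteq> d' \<Longrightarrow>
         \<exists>\<phi>. inj_on \<phi> (f1 \<union> f2) \<and> \<phi> ` f1 = d \<and> \<phi> ` f2 = d' \<and> \<phi> c = \<alpha> c
           \<and> \<phi> ` (f1 \<union> f2 - {c}) \<subseteq> U"
      using cherry_family[of U "\<alpha> c" f1 f2 c] U(1) edgeH ef c by metis
    have "insert (\<alpha> c) U \<subseteq> {1..n}" using aW Wn U by blast
    then have "F \<subseteq> ?Kn" using F(3) unfolding complete_graph_def by fastforce
    then have few_F: "card (f u ` F) \<le> k" if "u \<in> \<alpha> ` A" for u
      using few' that \<alpha>W Wn by blast
    have large_F: "card F > k ^ card (\<alpha> ` A)" using F(1) U(3) cAk by simp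
    obtain d d' where d: "d \<in> F" "d' \<in> F" "d \<noteq> d'"
      "\<forall>u\<in>\<alpha> ` A. f u d = f u d'"
      by (rule common_monochromatic_pair[OF F(2) finite_imageI[OF finA] few_F large_F])
    obtain \<phi> where \<phi>: "inj_on \<phi> (f1 \<union> f2)" "\<phi> ` f1 = d" "\<phi> ` f2 = d'" "\<phi> c = \<alpha> c"
        "\<phi> ` (f1 \<union> f2 - {c}) \<subseteq> U"
      using F(4)[OF d(1-3)] by blast
    have "B - A = f1 \<union> f2 - {c}" using AcB by (auto simp: B_def)
    then show ?thesis using \<phi> d(4) AcB by (intro that[of \<phi>]) (auto simp: B_def)
  qed
  have "card (verts H - A) \<le> card U"
    using card_mono[OF finH, of "verts H - A"] U(3) by (simp add: h_def)
  moreover have "B - A \<subseteq> verts H - A" "inj_on \<beta> (B - A)"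
    using AB \<beta>(1) by (auto intro: inj_on_subset)
  ultimately obtain \<gamma> where \<gamma>: "inj_on \<gamma> (verts H - A)" "\<gamma> ` (verts H - A) \<subseteq> U"
      "\<forall>v\<in>B - A. \<gamma> v = \<beta> v"
    using extend_injection[of "verts H - A" U "B - A" \<beta>] finH U(1) \<beta>(2) by blast
  define \<phi> where "\<phi> = (\<lambda>v. if v \<in> A then \<alpha> v else \<gamma> v)"
  have \<phi>A: "\<phi> v = \<alpha> v" if "v \<in> A" for v using that by (simp add: \<phi>_def)
  have \<phi>U: "\<phi> v \<in> U" if "v \<in> verts H - A" for v using that \<gamma>(2) by (auto simp: \<phi>_def)
  \<comment> \<open>On \<open>B - A\<close> this is the choice of \<open>\<gamma>\<close>; on
    \<open>A \<inter> B\<close> it is the agreement of \<open>\<beta>\<close> with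
    \<open>\<alpha>\<close>.\<close>
  have \<phi>B: "\<phi> v = \<beta> v" if "v \<in> B" for v using that \<gamma>(3) \<beta>(3) by (auto simp: \<phi>_def)
  have inj: "inj_on \<phi> (verts H)"
  proof -
    have 1: "inj_on \<phi> A" using \<alpha>(1) \<phi>A by (simp add: inj_on_def)
    have 2: "inj_on \<phi> (verts H - A)" using \<gamma>(1) by (simp add: inj_on_def \<phi>_def)
    have 3: "\<phi> ` A \<subseteq> ?W" using \<alpha>W \<phi>A by auto
    have 4: "\<phi> ` (verts H - A) \<subseteq> U" using \<phi>U by blast
    have "inj_on \<phi> (A \<union> (verts H - A))"
      unfolding inj_on_Un using 1 2 3 4 U(4) by blast
    then show ?thesis using AB(1) by (simp add: Un_absorb1)
  qed
  have range: "\<phi> ` verts H \<subseteq> {1..n}"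
  proof
    fix y assume "y \<in> \<phi> ` verts H"
    then obtain v where v: "v \<in> verts H" "y = \<phi> v" by blast
    show "y \<in> {1..n}"
    proof (cases "v \<in> A")
      case True
      then have "\<alpha> v \<in> ?W" using \<alpha>W by blast
      then show ?thesis using v \<phi>A[OF True] Wn by auto
    next
      case False
      then show ?thesis using v \<phi>U U(2) by blast
    qed
  qed
  define T where "T = \<lparr>verts = \<phi> ` verts H, edges = (\<lambda>e. \<phi> ` e) ` edges H\<rparr>"
  have edgeT: "\<phi> ` d \<subseteq> \<phi> ` verts H \<and> card (\<phi> ` d) = 2" if "d \<in> edges H" for d
    using edgeH[OF that] inj by (metis card_image image_mono inj_on_subset)
  have edgeKn: "\<phi> ` d \<in> ?Kn" if "d \<in> edges H" for d
    unfolding Kn using edgeT[OF that] range by (meson order_trans)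
  have "simple_graph T"
    using edgeT finH by (auto simp: simple_graph_def T_def)
  moreover have "verts T \<subseteq> verts (complete_graph n)"
    using range by (simp add: T_def complete_graph_def)
  moreover have "edges T \<subseteq> ?Kn" using edgeKn by (auto simp: T_def)
  moreover have "graph_isomorphic H T"
    unfolding graph_isomorphic_def
    by (rule exI[of _ \<phi>]) (simp add: T_def bij_betw_def inj)
  ultimately have "T \<in> copies n H" by (simp add: copies_def subgraph_def)
  then obtain u where u: "u \<in> verts T" "inj_on (f u) (edges T)"
    using loc unfolding local_collection_def by blast
  \<comment> \<open>Injectivity of \<open>\<phi>\<close> keeps distinct edges of \<open>H\<close>
    distinct in \<open>T\<close>, so a repeated colour at \<open>u\<close> on two such images is a
    contradiction.\<close>
  have rainbow: "f u (\<phi> ` d) \<noteq> f u (\<phi> ` d')" if "d \<in> edges H" "d' \<in> edges H" "d \<noteq> d'" for d d'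
  proof -
    have "\<phi> ` d \<noteq> \<phi> ` d'"
      using inj_on_image_eq_iff[OF inj edgeH(1)[OF that(1)] edgeH(1)[OF that(2)]] that(3) by simp
    moreover have "\<phi> ` d \<in> edges T" "\<phi> ` d' \<in> edges T" using that by (auto simp: T_def)
    ultimately show ?thesis using inj_on_eq_iff[OF u(2)] by blast
  qed
  obtain v where v: "v \<in> verts H" "u = \<phi> v" using u(1) by (auto simp: T_def)
  show False
  proof (cases "v \<in> A")
    case True
    have "\<phi> ` f1 = \<beta> ` f1" "\<phi> ` f2 = \<beta> ` f2" using \<phi>B by (auto simp: B_def)
    moreover have "u \<in> \<alpha> ` A" using v True \<phi>A by simp
    ultimately show False using rainbow[OF ef(3,4)] dist \<beta>(4) by simp
  next
    case False
    have "\<phi> ` e1 = e" "\<phi> ` e2 = e'" using \<phi>A \<alpha>(2,3) by (auto simp: A_def)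
    moreover have "u \<in> U" using v False \<phi>U by simp
    ultimately show False using rainbow[OF ef(1,2)] dist Uf by simp
  qed
qed

section \<open>From the polynomial bound to the growth rate\<close>

theorem theorem3p4:
  fixes H :: "'a graph"
  assumes "simple_graph H" and "nice H"
  shows "(\<lambda>n. real (g n H)) \<in> \<Omega>(\<lambda>n. real n powr (1/6))"
proof -
  define C where "C = 6 + card (verts H)"
  obtain e where e: "e \<in> edges H" using assms(2) by (auto simp: nice_def)
  then have "e \<subseteq> verts H" "card e = 2" using assms(1) by (auto simp: simple_graph_def)
  then have ne: "verts H \<noteq> {}" by auto
  have bound: "n \<le> C * (g n H + 1) ^ 6" for n
    using g_attained[OF ne, of n] local_collection_bound[OF assms] by (auto simp: C_def)
  have "real n powr (1/6) \<le> 2 * real C powr (1/6) * real (g n H)" if "n > C" for n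
  proof -
    \<comment> \<open>If \<open>g n H\<close> were 0, the bound would give \<open>n \<le> C\<close>.
      Being at least 1, it satisfies \<open>g n H + 1 \<le> 2 * g n H\<close>, which absorbs the
      added 1 into the constant factor 2.\<close>
    have "g n H \<noteq> 0"
      using bound[of n] that by (intro notI) simp
    have "real n \<le> real C * real (g n H + 1) ^ 6"
      using bound[of n] by (metis of_nat_le_iff of_nat_mult of_nat_power)
    also have "\<dots> \<le> real C * (2 * real (g n H)) ^ 6"
      using \<open>g n H \<noteq> 0\<close> by (intro mult_left_mono power_mono) auto
    finally have "real n powr (1/6) \<le> (real C * (2 * real (g n H)) ^ 6) powr (1/6)"
      by (intro powr_mono2) auto
    also have "\<dots> = real C powr (1/6) * (2 * real (g n H))"
    proof -
      \<comment> \<open>Writing the sixth power with \<open>powr\<close> lets the exponents 6 and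
        1/6 cancel.\<close>
      have "(2 * real (g n H)) ^ 6 = (2 * real (g n H)) powr 6"
        using \<open>g n H \<noteq> 0\<close> by (intro powr_numeral[symmetric]) simp
      then have "((2 * real (g n H)) ^ 6) powr (1/6) = 2 * real (g n H)"
        by (simp only: powr_powr) simp
      then show ?thesis by (simp only: powr_mult)
    qed
    finally show ?thesis by (simp add: mult_ac)
  qed
  then have "(\<lambda>n. real n powr (1/6)) \<in> O(\<lambda>n. real (g n H))"
    by (intro bigoI[where c = "2 * real C powr (1/6)"])
       (auto intro!: eventually_mono[OF eventually_gt_at_top[of C]])
  then show ?thesis by (simp add: bigomega_iff_bigo)
qed

end
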